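(* For any non-disclosure region $\mathcal{Y}^{N}\subseteq\mathbb{R}$, there exists a unique equilibrium of the receivers' continuation game. This equilibrium has the following properties: 1. Receiver $i$ undertakes $a_i=1$ if and only if her private signal $x_i$ exceeds a threshold $\hat{x}(m)$ (that is, $a_i=\mathbf{1}_{x_i\ge\hat{x}(m)}$), where $m\in(\mathbb{R}\setminus\mathcal{Y}^{N})\cup\{\varnothing\}$. 2. Upon receiving the message $m=y$, the threshold $\hat{x}(y)$ is linear and strictly decreasing in $y$: $$\hat{x}(y)=-\frac{1}{\beta}(\alpha y+\gamma\mu).$$ 3. If no message is transmitted, $m=\varnothing$, the threshold $\hat{x}(\varnothing)$ is implicitly defined by $$(1-p)\,\bar\theta(\hat{x}(\varnothing))+p\int_{\mathcal{Y}^{N}}\frac{\int_{\mathbb{R}}\theta f(y|\theta)f(\theta|\hat{x}(\varnothing))\,d\theta}{\int_{\mathcal{Y}^{N}}f(y'|\hat{x}(\varnothing))\,dy'}\,dy=0 .$$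
   Context: Environment. The parameters are precisions $\alpha,\beta,\gamma>0$, a prior mean $\mu\in\mathbb{R}$, an externality parameter $r\in\mathbb{R}$ and a probability $p\in(0,1)$. A fundamental $\theta\sim N(\mu,\gamma^{-1})$ is unobserved. There is a continuum of receivers $i\in[0,1]$; receiver $i$ observes a private signal $x_i$ with $x_i|\theta\sim N(\theta,\beta^{-1})$, conditionally i.i.d. across receivers. With probability $p$ a Sender observes a signal $y$ with $y|\theta\sim N(\theta,\alpha^{-1})$, conditionally independent of all $x_i$; with probability $1-p$ he observes nothing ($y=\varnothing$). The Sender sends a public message $m\in\mathbb{R}\cup\{\varnothing\}$: if he observed $y\in\mathcal{Y}^{N}$, or nothing, he sends $m=\varnothing$; otherwise he sends $m=y$ (messages cannot be falsified). Each receiver, after observing $(x_i,m)$, chooses $a_i\in\{0,1\}$ ($1$ = risky, $0$ = safe), with realized payoff $rA+a_i\theta$, where $A=\int_0^1 a_i\,di$ is the aggregate action (unaffected by any single receiver's choice). Notation. $f(\cdot)$ and $f(\cdot|\cdot)$ denote the (conditional) densities of the random variables named in the arguments, computed from the joint normal law of $(\theta,x,y)$, where $x$ is a generic private signal. $\bar\theta(x)=\mathbb{E}[\theta|x]=\frac{\beta x+\gamma\mu}{\beta+\gamma}$. Receivers' posteriors. After $m=y$, the posterior density of $\theta$ is $f(\theta|y,x_i)$. After $m=\varnothing$, the posterior density is specified as $$f(\theta|\varnothing,x_i)=\left(1-p+p\int_{\mathcal{Y}^{N}}\frac{f(y|\theta,x_i)}{\int_{\mathcal{Y}^{N}}f(y'|x_i)\,dy'}\,dy\right)f(\theta|x_i).$$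 Equilibrium of the continuation game (given $m$): a strategy profile in which each receiver's action maximizes her expected payoff $\mathbb{E}[rA+a_i\theta\,|\,x_i,m]$ under the posterior above, taking the others' strategies as given; a receiver who is exactly indifferent is taken to choose $a_i=1$. *)

theory Defs
  imports "HOL-Probability.Probability"
begin

text \<open>
  Parameters: precisions \<open>\<alpha>\<close> (Sender's signal), \<open>\<beta>\<close> (receivers' signals) and \<open>\<gamma>\<close> (prior), prior
  mean \<open>\<mu>\<close>, externality \<open>r\<close>, probability \<open>p\<close> that the Sender is informed, and non-disclosure
  region \<open>N\<close>. A definition takes as arguments, in this order, those parameters on which it
  depends.
\<close>

context
  fixes \<alpha> \<beta> \<gamma> \<mu> r p :: real and N :: "real set"
begin

text \<open>
  The joint density of \<open>(\<theta>, x, y)\<close>: \<open>\<theta>\<close> is normal, and \<open>x\<close>, \<open>y\<close> are normal around \<open>\<theta>\<close> and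
  independent given \<open>\<theta>\<close>. The second argument of \<^const>\<open>normal_density\<close> is the standard deviation,
  i.e. the inverse square root of the precision.
\<close>

definition f_joint :: "real \<Rightarrow> real \<Rightarrow> real \<Rightarrow> real" where
  "f_joint \<theta> x y = normal_density \<mu> (1 / sqrt \<gamma>) \<theta> *
     normal_density \<theta> (1 / sqrt \<beta>) x * normal_density \<theta> (1 / sqrt \<alpha>) y"

definition f_theta_x :: "real \<Rightarrow> real \<Rightarrow> real" where
  "f_theta_x \<theta> x = (LINT y|lborel. f_joint \<theta> x y)"

definition f_theta_y :: "real \<Rightarrow> real \<Rightarrow> real" where
  "f_theta_y \<theta> y = (LINT x|lborel. f_joint \<theta> x y)"

definition f_y_x :: "real \<Rightarrow> real \<Rightarrow> real" where
  "f_y_x y x = (LINT \<theta>|lborel. f_joint \<theta> x y)"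

definition f_theta :: "real \<Rightarrow> real" where
  "f_theta \<theta> = (LINT x|lborel. f_theta_x \<theta> x)"

definition f_x :: "real \<Rightarrow> real" where
  "f_x x = (LINT \<theta>|lborel. f_theta_x \<theta> x)"

definition f_theta_given_x :: "real \<Rightarrow> real \<Rightarrow> real" where
  "f_theta_given_x \<theta> x = f_theta_x \<theta> x / f_x x"

definition f_x_given_theta :: "real \<Rightarrow> real \<Rightarrow> real" where
  "f_x_given_theta x \<theta> = f_theta_x \<theta> x / f_theta \<theta>"

definition f_y_given_theta :: "real \<Rightarrow> real \<Rightarrow> real" where
  "f_y_given_theta y \<theta> = f_theta_y \<theta> y / f_theta \<theta>"

definition f_y_given_x :: "real \<Rightarrow> real \<Rightarrow> real" where
  "f_y_given_x y x = f_y_x y x / f_x x"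

definition f_y_given_theta_x :: "real \<Rightarrow> real \<Rightarrow> real \<Rightarrow> real" where
  "f_y_given_theta_x y \<theta> x = f_joint \<theta> x y / f_theta_x \<theta> x"

definition f_theta_given_y_x :: "real \<Rightarrow> real \<Rightarrow> real \<Rightarrow> real" where
  "f_theta_given_y_x \<theta> y x = f_joint \<theta> x y / f_y_x y x"

definition theta_bar :: "real \<Rightarrow> real" where
  "theta_bar x = (LINT \<theta>|lborel. \<theta> * f_theta_given_x \<theta> x)"

text \<open>
  A message is \<open>Some y\<close> for a disclosed signal \<open>y\<close>, and \<open>None\<close> for the absence of a message.
\<close>

definition messages :: "real option set" where
  "messages = insert None (Some ` (- N))"

text \<open>
  Integrals over \<open>N\<close> are taken with respect to \<^const>\<open>lebesgue\<close> so that \<open>N\<close> may be any Lebesgue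
  measurable set. If \<open>N\<close> is a null set, the outer integral in the case \<open>None\<close> is \<open>0\<close>, whatever
  value is given to the undefined quotient; the "posterior" is then \<open>1 - p\<close> times
  \<open>f(\<theta>|x)\<close>.
\<close>

definition posterior :: "real option \<Rightarrow> real \<Rightarrow> real \<Rightarrow> real" where
  "posterior m x \<theta> = (case m of
       Some y \<Rightarrow> f_theta_given_y_x \<theta> y x
     | None \<Rightarrow> (1 - p + p * (LINT y:N|lebesgue.
           f_y_given_theta_x y \<theta> x / (LINT y':N|lebesgue. f_y_given_x y' x)))
         * f_theta_given_x \<theta> x)"

text \<open>
  A strategy profile of the continuation game at a fixed message: \<open>s i x\<close> is the action of
  receiver \<open>i \<in> [0,1]\<close> at private signal \<open>x\<close>. Joint measurability makes the aggregate action
  well defined, and \<open>\<rightarrow>\<^sub>E\<close> fixes the irrelevant values at indices outside \<open>[0,1]\<close>.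
\<close>

definition profiles :: "(real \<Rightarrow> real \<Rightarrow> real) set" where
  "profiles = {s \<in> {0..1} \<rightarrow>\<^sub>E (UNIV \<rightarrow> {0, 1}).
     (\<lambda>(i, x). s i x) \<in> borel_measurable (restrict_space borel {0..1} \<Otimes>\<^sub>M borel)}"

text \<open>
  The conditional mean given \<open>\<theta>\<close> of the aggregate action \<open>A = \<integral>\<^sub>0\<^sup>1 a\<^sub>j dj\<close>. Given \<open>\<theta>\<close>, the signals of
  the other receivers are independent of \<open>(x\<^sub>i, m)\<close>, and a single receiver has measure zero in
  \<open>[0,1]\<close>; as payoffs are linear in \<open>A\<close>, this is all that enters a receiver's expected payoff.
  (It is also the realized value of \<open>A\<close> under the law of large numbers convention for a continuum
  of conditionally i.i.d. signals.)
\<close>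

definition aggregate :: "(real \<Rightarrow> real \<Rightarrow> real) \<Rightarrow> real \<Rightarrow> real" where
  "aggregate s \<theta> =
     (LINT j:{0..1}|lborel. (LINT x|lborel. s j x * f_x_given_theta x \<theta>))"

text \<open>\<open>E[r A + a \<theta> | x, m]\<close> for a receiver with signal \<open>x\<close> who takes action \<open>a\<close>.\<close>

definition expected_payoff ::
  "real option \<Rightarrow> (real \<Rightarrow> real \<Rightarrow> real) \<Rightarrow> real \<Rightarrow> real \<Rightarrow> real" where
  "expected_payoff m s x a =
     (LINT \<theta>|lborel. (r * aggregate s \<theta> + a * \<theta>) * posterior m x \<theta>)"

definition equilibrium :: "real option \<Rightarrow> (real \<Rightarrow> real \<Rightarrow> real) \<Rightarrow> bool" where
  "equilibrium m s \<longleftrightarrow> s \<in> profiles \<and>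
     (\<forall>i\<in>{0..1}. \<forall>x.
        (\<forall>a\<in>{0, 1}. expected_payoff m s x a \<le> expected_payoff m s x (s i x)) \<and>
        (expected_payoff m s x 0 = expected_payoff m s x 1 \<longrightarrow> s i x = 1))"

end

end

theory Submission
  imports Defs
begin

text \<open>
  The externality is additively separable, so a receiver's best response depends only on the sign of
  her posterior mean of \<open>\<theta>\<close> and not on the other receivers: everything reduces to showing that this
  mean, as a function of her signal \<open>x\<close>, changes sign exactly once, from negative to positive. After
  \<open>m = y\<close> it is affine in \<open>x\<close>. After silence it is \<open>(1 - p) E[\<theta>|x] + p E[\<theta>|x, y \<in> N]\<close>. Here
  \<open>E[\<theta>|x]\<close> is affine and strictly increasing, and the law of \<open>\<theta>\<close> given \<open>x\<close> and \<open>y \<in> N\<close> is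
  proportional to \<open>exp (\<beta> x \<theta>)\<close> times a weight that is free of \<open>x\<close>, i.e. an exponential family in
  \<open>x\<close>; so the second mean is continuous and increasing, and the sum has a unique root.
\<close>

section \<open>Normal densities parametrised by precision\<close>

abbreviation normal_prec :: "real \<Rightarrow> real \<Rightarrow> real \<Rightarrow> real" where
  "normal_prec a m \<equiv> normal_density m (1 / sqrt a)"

text \<open>The mean must be allowed to vary with the argument: in the mixtures below it is itself
  the integration variable.\<close>

lemma borel_measurable_normal_density_mean [measurable (raw)]:
  assumes [measurable]: "f \<in> borel_measurable M" "g \<in> borel_measurable M"
  shows "(\<lambda>x. normal_density (f x) \<sigma> (g x)) \<in> borel_measurable M"
  unfolding normal_density_def by measurable

lemma normal_density_commute: "normal_density m \<sigma> t = normal_density t \<sigma> m"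
  by (simp add: normal_density_def power2_commute)

lemma normal_prec_eq:
  assumes "a > 0"
  shows "normal_prec a m t = sqrt (a / (2 * pi)) * exp (- (a * (t - m)\<^sup>2 / 2))"
  using assms by (simp add: normal_density_def power_divide real_sqrt_divide field_simps)

text \<open>Bayesian updating of normals by completing the square: precisions add and means average
  with precision weights. Only the independence of \<open>C\<close> from \<open>t\<close> matters,
  since it cancels on normalisation.\<close>

lemma normal_prec_product:
  assumes "a > 0" "b > 0"
  obtains C where "C > 0"
    "\<And>t. normal_prec a m t * normal_prec b n t = C * normal_prec (a + b) ((a * m + b * n) / (a + b)) t"
proof
  \<comment> \<open>The remainder left by completing the square in \<open>t\<close>.\<close>
  define k where "k = a * m\<^sup>2 + b * n\<^sup>2 - (a * m + b * n)\<^sup>2 / (a + b)"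
  define C where "C = sqrt (a / (2 * pi)) * sqrt (b / (2 * pi)) / sqrt ((a + b) / (2 * pi)) * exp (- (k / 2))"
  show "C > 0" using assms by (simp add: C_def)
  fix t
  have "a * (t - m)\<^sup>2 + b * (t - n)\<^sup>2 = (a + b) * (t - (a * m + b * n) / (a + b))\<^sup>2 + k"
    using assms unfolding k_def by (simp add: divide_simps add_pos_pos[THEN less_imp_neq, symmetric]) algebra
  then have "- (a * (t - m)\<^sup>2 / 2) + - (b * (t - n)\<^sup>2 / 2)
      = - ((a + b) * (t - (a * m + b * n) / (a + b))\<^sup>2 / 2) + - (k / 2)"
    by linarith
  then have "exp (- (a * (t - m)\<^sup>2 / 2)) * exp (- (b * (t - n)\<^sup>2 / 2))
      = exp (- ((a + b) * (t - (a * m + b * n) / (a + b))\<^sup>2 / 2)) * exp (- (k / 2))"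
    by (simp only: exp_add[symmetric])
  moreover have "sqrt ((a + b) / (2 * pi)) \<noteq> 0" using assms by simp
  ultimately show "normal_prec a m t * normal_prec b n t = C * normal_prec (a + b) ((a * m + b * n) / (a + b)) t"
    using assms by (simp add: normal_prec_eq C_def del: real_sqrt_eq_0_iff)
qed

text \<open>Completing the square again: a tilt shifts the mean and keeps the precision. The factor
  is the moment generating function of the normal law at \<open>s\<close>.\<close>

lemma normal_prec_tilt:
  assumes "a > 0"
  obtains C where "C > 0" "\<And>t. exp (s * t) * normal_prec a m t = C * normal_prec a (m + s / a) t"
proof
  define C where "C = exp (s * m + s\<^sup>2 / (2 * a))"
  show "C > 0" by (simp add: C_def)
  fix t
  have "s * t + - (a * (t - m)\<^sup>2 / 2) = (s * m + s\<^sup>2 / (2 * a)) + - (a * (t - (m + s / a))\<^sup>2 / 2)"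
    using assms by (simp add: divide_simps) algebra
  then have "exp (s * t) * exp (- (a * (t - m)\<^sup>2 / 2)) = C * exp (- (a * (t - (m + s / a))\<^sup>2 / 2))"
    unfolding C_def by (simp only: exp_add[symmetric])
  then show "exp (s * t) * normal_prec a m t = C * normal_prec a (m + s / a) t"
    using assms by (simp add: normal_prec_eq)
qed

lemma normal_prec_moment:
  assumes "a > 0"
  shows "integrable lborel (\<lambda>t. t * normal_prec a m t)" "(LINT t|lborel. t * normal_prec a m t) = m"
  using integrable_normal_moment_nz_1[of "1 / sqrt a" m] integral_normal_moment_nz_1[of "1 / sqrt a" m] assms
  by (simp_all add: mult.commute)

section \<open>Exponential families\<close>

text \<open>Dominated convergence for \<open>s\<close> in a compact interval:
  \<open>exp (s * t)\<close> is at most the sum of its values at the two endpoints, whatever the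
  sign of \<open>t\<close>.\<close>

lemma integral_exp_tilt_continuous:
  fixes g :: "real \<Rightarrow> real"
  assumes int: "\<And>s. integrable lborel (\<lambda>t. exp (s * t) * g t)"
  shows "continuous_on UNIV (\<lambda>s. LINT t|lborel. exp (s * t) * g t)"
proof -
  have "continuous_on {a..b} (\<lambda>s. LINT t|lborel. exp (s * t) * g t)" for a b
    unfolding continuous_on_sequentially
  proof (intro ballI allI impI, unfold o_def)
    fix X :: "nat \<Rightarrow> real" and s
    assume X: "(\<forall>n. X n \<in> {a..b}) \<and> X \<longlonglongrightarrow> s"
    show "(\<lambda>n. LINT t|lborel. exp (X n * t) * g t) \<longlonglongrightarrow> (LINT t|lborel. exp (s * t) * g t)"
    proof (rule integral_dominated_convergence
        [where w = "\<lambda>t. norm (exp (a * t) * g t) + norm (exp (b * t) * g t)"])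
      have "exp (X n * t) \<le> exp (a * t) + exp (b * t)" for n t
      proof -
        have "X n * t \<le> a * t \<or> X n * t \<le> b * t"
          using X by (cases "t \<ge> 0") (auto intro: mult_right_mono mult_right_mono_neg)
        then show ?thesis by (auto intro: add_increasing add_increasing2)
      qed
      then have "exp (X n * t) * \<bar>g t\<bar> \<le> (exp (a * t) + exp (b * t)) * \<bar>g t\<bar>" for n t
        by (intro mult_right_mono) auto
      then show "AE t in lborel. norm (exp (X n * t) * g t) \<le> norm (exp (a * t) * g t) + norm (exp (b * t) * g t)" for n
        by (simp add: abs_mult distrib_right)
      show "AE t in lborel. (\<lambda>n. exp (X n * t) * g t) \<longlonglongrightarrow> exp (s * t) * g t"
        using X by (intro AE_I2) (auto intro!: tendsto_intros)
    qed (use int in \<open>auto intro: borel_measurable_integrable\<close>)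
  qed
  \<comment> \<open>Continuity is local, so compact intervals around each point suffice.\<close>
  then have "isCont (\<lambda>s. LINT t|lborel. exp (s * t) * g t) s" for s
    using continuous_on_interior[of "{s - 1..s + 1}"] by fastforce
  then show ?thesis by (simp add: continuous_on_eq_continuous_at)
qed

text \<open>
  The increase is \<open>Cov (t, exp (d t)) \<ge> 0\<close> under the tilted law, and integrating
  \<open>(t - m) (exp (d t) - exp (d m)) \<ge> 0\<close> against that law shows this when \<open>m\<close> is its mean.
\<close>

lemma tilted_mean_mono:
  fixes w :: "real \<Rightarrow> real"
  assumes nonneg: "\<And>t. 0 \<le> w t"
    and int0: "\<And>s. integrable lborel (\<lambda>t. exp (s * t) * w t)"
    and int1: "\<And>s. integrable lborel (\<lambda>t. exp (s * t) * (t * w t))"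
    and pos: "\<And>s. 0 < (LINT t|lborel. exp (s * t) * w t)"
  shows "mono (\<lambda>s. (LINT t|lborel. exp (s * t) * (t * w t)) / (LINT t|lborel. exp (s * t) * w t))"
proof (rule monoI)
  fix s s' :: real assume "s \<le> s'"
  define m where "m = (LINT t|lborel. exp (s * t) * (t * w t)) / (LINT t|lborel. exp (s * t) * w t)"
  define c where "c = exp ((s' - s) * m)"
  have "0 \<le> (LINT t|lborel. (t - m) * (exp ((s' - s) * t) - c) * (exp (s * t) * w t))"
  proof (rule Bochner_Integration.integral_nonneg)
    fix t
    have "0 \<le> (t - m) * (exp ((s' - s) * t) - c)"
      using \<open>s \<le> s'\<close> linear[of m t] by (auto simp: c_def zero_le_mult_iff intro: mult_left_mono)
    then show "0 \<le> (t - m) * (exp ((s' - s) * t) - c) * (exp (s * t) * w t)"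
      using nonneg by simp
  qed
  also have "\<dots> = (LINT t|lborel. (exp (s' * t) * (t * w t) - m * (exp (s' * t) * w t))
      - c * (exp (s * t) * (t * w t) - m * (exp (s * t) * w t)))"
    by (intro Bochner_Integration.integral_cong refl)
      (simp add: left_diff_distrib exp_diff field_simps)
  \<comment> \<open>The part multiplied by \<open>c\<close> integrates to 0, because
    \<open>m\<close> is the mean at \<open>s\<close>.\<close>
  also have "\<dots> = (LINT t|lborel. exp (s' * t) * (t * w t)) - m * (LINT t|lborel. exp (s' * t) * w t)"
    using pos[of s] by (simp add: int0 int1 m_def)
  finally show "m \<le> (LINT t|lborel. exp (s' * t) * (t * w t)) / (LINT t|lborel. exp (s' * t) * w t)"
    using pos[of s'] by (simp add: field_simps)
qed

text \<open>The linear term makes the sum strictly increasing and drives it through 0; continuity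
  supplies the root.\<close>

lemma linear_plus_mono_root:
  fixes h :: "real \<Rightarrow> real"
  assumes "k > 0" "mono h" "continuous_on UNIV h"
  obtains z where "\<And>x. 0 \<le> k * x + h x \<longleftrightarrow> z \<le> x" "\<And>x. k * x + h x = 0 \<longleftrightarrow> x = z"
proof -
  \<comment> \<open>Chosen so that at \<open>b\<close> and \<open>- b\<close> the linear term
    outweighs \<open>h 0\<close>; monotonicity of \<open>h\<close> then gives the signs needed for
    the intermediate value theorem.\<close>
  define b where "b = \<bar>h 0\<bar> / k"
  have "0 \<le> b" "k * b = \<bar>h 0\<bar>" using assms by (simp_all add: b_def)
  moreover have "h (- b) \<le> h 0" "h 0 \<le> h b" using \<open>mono h\<close> \<open>0 \<le> b\<close> by (auto elim: monoD)
  ultimately have "\<exists>z. - b \<le> z \<and> z \<le> b \<and> k * z + h z = 0"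
    using assms(3) by (intro IVT')
      (auto intro!: continuous_intros intro: continuous_on_subset)
  then obtain z where z: "k * z + h z = 0" by blast
  have less: "k * x + h x < k * y + h y" if "x < y" for x y
    using \<open>k > 0\<close> monoD[OF \<open>mono h\<close>, of x y] that by (intro add_less_le_mono) auto
  show thesis
  proof
    fix x
    show "0 \<le> k * x + h x \<longleftrightarrow> z \<le> x" "k * x + h x = 0 \<longleftrightarrow> x = z"
      using less[of x z] less[of z x] z by (cases x z rule: linorder_cases; force)+
  qed
qed

section \<open>The normal measure of a set\<close>

text \<open>A Lebesgue set is a Borel set up to a null set. One \<open>S\<close>, fixed before
  \<open>f\<close>, serves every Borel integrand, which gives access to Fubini for
  \<open>lborel\<close>.\<close>

lemma lebesgue_set_borel_representative:
  assumes "N \<in> sets lebesgue"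
  obtains S where "S \<in> sets borel"
    "\<And>f :: real \<Rightarrow> real. f \<in> borel_measurable borel \<Longrightarrow> (LINT y:N|lebesgue. f y) = (LINT y:S|lborel. f y)"
proof -
  obtain S Z Z' where *: "N = S \<union> Z" "Z \<subseteq> Z'" "Z' \<in> null_sets lborel" "S \<in> sets lborel"
    using assms by (rule sets_completionE)
  have "AE y in lebesgue. y \<notin> Z'"
    using AE_not_in[OF *(3)] by (rule AE_completion)
  then have AE: "AE y in lebesgue. indicator N y = (indicator S y :: real)"
    by eventually_elim (use * in \<open>auto simp: indicator_def\<close>)
  have "(LINT y:N|lebesgue. f y) = (LINT y:S|lborel. f y)" if [measurable]: "f \<in> borel_measurable borel"
    for f :: "real \<Rightarrow> real"
  proof -
    have [measurable]: "S \<in> sets borel" using * by simp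
    have f: "f \<in> borel_measurable lebesgue" by (simp add: measurable_completion)
    have "(LINT y:N|lebesgue. f y) = (LINT y:S|lebesgue. f y)"
      unfolding set_lebesgue_integral_def
      by (intro integral_cong_AE borel_measurable_scaleR borel_measurable_indicator f assms)
        (use AE * in auto)
    also have "\<dots> = (LINT y:S|lborel. f y)"
      unfolding set_lebesgue_integral_def by (intro integral_completion) measurable
    finally show ?thesis .
  qed
  with * show thesis by (intro that[of S]) auto
qed

context
  fixes S :: "real set" and a :: real
  assumes S [measurable]: "S \<in> sets borel" and a: "a > 0"
begin

text \<open>With \<open>a\<close> the precision of the Sender's signal, this is the probability that
  \<open>y\<close> falls in \<open>S\<close> given that the fundamental is \<open>t\<close>.\<close>

definition normal_set :: "real \<Rightarrow> real" where
  "normal_set t = (LINT y:S|lborel. normal_prec a t y)"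

lemma borel_measurable_normal_set [measurable]: "normal_set \<in> borel_measurable borel"
  unfolding normal_set_def set_lebesgue_integral_def by measurable

lemma set_integrable_normal_prec: "set_integrable lborel S (normal_prec a t)"
  unfolding set_integrable_def using a by (intro integrable_mult_indicator) auto

lemma normal_set_nonneg: "0 \<le> normal_set t"
  unfolding normal_set_def set_lebesgue_integral_def by (intro Bochner_Integration.integral_nonneg) (simp add: indicator_def)

lemma normal_set_le_1: "normal_set t \<le> 1"
proof -
  have "normal_set t \<le> (LINT y|lborel. normal_prec a t y)"
    unfolding normal_set_def set_lebesgue_integral_def using set_integrable_normal_prec a
    by (intro integral_mono) (auto simp: indicator_def set_integrable_def)
  then show ?thesis using a by simp
qed

text \<open>Normal densities are strictly positive, so the value vanishes exactly when
  \<open>S\<close> is Lebesgue null, a condition free of \<open>t\<close>.\<close>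

lemma normal_set_zero_or_pos: "(\<forall>t. normal_set t = 0) \<or> (\<forall>t. 0 < normal_set t)"
proof (cases "AE y in lborel. y \<notin> S")
  case True
  then have "normal_set t = 0" for t
    unfolding normal_set_def set_lebesgue_integral_def
    by (intro integral_eq_zero_AE) (auto elim!: eventually_mono)
  then show ?thesis by simp
next
  case False
  have "normal_set t \<noteq> 0" for t
  proof
    assume "normal_set t = 0"
    then have "AE y in lborel. indicator S y *\<^sub>R normal_prec a t y = 0"
      using set_integrable_normal_prec[of t]
      by (subst (asm) normal_set_def, unfold set_lebesgue_integral_def set_integrable_def,
          subst (asm) integral_nonneg_eq_0_iff_AE) (auto simp: indicator_def)
    then have "AE y in lborel. y \<notin> S"
      by eventually_elim
        (use a normal_density_pos[of "1 / sqrt a" t] in \<open>auto simp: indicator_def less_le split: if_splits\<close>)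
    with False show False ..
  qed
  then show ?thesis using normal_set_nonneg by (simp add: less_le)
qed

lemma integrable_mult_normal_set:
  assumes "integrable lborel g"
  shows "integrable lborel (\<lambda>t. g t * normal_set t)"
proof (rule Bochner_Integration.integrable_bound[OF assms])
  have [measurable]: "g \<in> borel_measurable borel" using borel_measurable_integrable[OF assms] by simp
  show "(\<lambda>t. g t * normal_set t) \<in> borel_measurable lborel" by measurable
  show "AE t in lborel. norm (g t * normal_set t) \<le> norm (g t)"
    using normal_set_nonneg normal_set_le_1 by (simp add: abs_mult mult_left_le)
qed

text \<open>Fubini, justified by \<open>normal_set\<close> being at most 1. Taking \<open>g\<close>
  to be the receiver's density of \<theta>, or \<theta> times it, gives the denominator and
  numerator of the silent mean.\<close>

lemma set_integral_normal_mixture: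
  assumes g: "integrable lborel g"
  shows "(LINT y:S|lborel. LINT t|lborel. g t * normal_prec a t y) = (LINT t|lborel. g t * normal_set t)"
proof -
  define f where "f = (\<lambda>t y. g t * (indicator S y * normal_prec a t y))"
  have [measurable]: "g \<in> borel_measurable borel" using borel_measurable_integrable[OF g] by simp
  have f_int: "(LINT y|lborel. f t y) = g t * normal_set t" for t
    by (simp add: f_def normal_set_def set_lebesgue_integral_def)
  have abs_f_int: "(LINT y|lborel. \<bar>f t y\<bar>) = \<bar>g t\<bar> * normal_set t" for t
    by (simp add: f_def normal_set_def set_lebesgue_integral_def abs_mult)
  have "integrable (lborel \<Otimes>\<^sub>M lborel) (case_prod f)"
  proof (rule lborel_pair.Fubini_integrable)
    show "case_prod f \<in> borel_measurable (lborel \<Otimes>\<^sub>M lborel)" unfolding f_def by measurable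
    show "integrable lborel (\<lambda>t. LINT y|lborel. norm (case_prod f (t, y)))"
      using integrable_mult_normal_set[OF integrable_abs[OF g]] by (simp add: abs_f_int)
    show "AE t in lborel. integrable lborel (\<lambda>y. case_prod f (t, y))"
      using set_integrable_normal_prec by (auto simp: f_def set_integrable_def)
  qed
  then have "(LINT y|lborel. LINT t|lborel. f t y) = (LINT t|lborel. LINT y|lborel. f t y)"
    by (rule lborel_pair.Fubini_integral)
  moreover have "(LINT y:S|lborel. LINT t|lborel. g t * normal_prec a t y) = (LINT y|lborel. LINT t|lborel. f t y)"
    unfolding set_lebesgue_integral_def f_def
    by (simp add: mult.left_commute[of _ "indicator S _"] flip: integral_mult_right_zero)
  ultimately show ?thesis by (simp add: f_int)
qed

end

section \<open>Best responses\<close>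

text \<open>The restriction to \<open>{0..1}\<close> matches the extensional function space in
  \<open>profiles\<close>, so that uniqueness can be stated as an equality of functions.\<close>

definition threshold_profile :: "real \<Rightarrow> real \<Rightarrow> real \<Rightarrow> real" where
  "threshold_profile z = (\<lambda>i\<in>{0..1}. \<lambda>x. if x \<ge> z then 1 else 0)"

lemma threshold_profile_in_profiles: "threshold_profile z \<in> profiles"
proof -
  have "(\<lambda>p. if snd p \<ge> z then 1 else 0 :: real) \<in> borel_measurable (restrict_space borel {0..1::real} \<Otimes>\<^sub>M borel)"
    by measurable
  then have "(\<lambda>(i, x). threshold_profile z i x) \<in> borel_measurable (restrict_space borel {0..1} \<Otimes>\<^sub>M borel)"
    by (rule measurable_cong[THEN iffD1, rotated])
      (auto simp: threshold_profile_def space_pair_measure space_restrict_space)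
  moreover have "threshold_profile z \<in> {0..1} \<rightarrow>\<^sub>E (UNIV \<rightarrow> {0, 1})"
    by (auto simp: threshold_profile_def)
  ultimately show ?thesis by (simp add: profiles_def)
qed

context
  fixes \<alpha> \<beta> \<gamma> \<mu> r p :: real and N :: "real set"
  assumes pos: "\<alpha> > 0" "\<beta> > 0" "\<gamma> > 0"
begin

section \<open>Closed forms of the conditional densities\<close>

lemma f_theta_x_eq: "f_theta_x \<alpha> \<beta> \<gamma> \<mu> \<theta> x = normal_prec \<gamma> \<mu> \<theta> * normal_prec \<beta> \<theta> x"
  using pos by (simp add: f_theta_x_def f_joint_def)

lemma f_theta_eq: "f_theta \<alpha> \<beta> \<gamma> \<mu> \<theta> = normal_prec \<gamma> \<mu> \<theta>"
  using pos by (simp add: f_theta_def f_theta_x_eq)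

lemma f_x_given_theta_eq: "f_x_given_theta \<alpha> \<beta> \<gamma> \<mu> x \<theta> = normal_prec \<beta> \<theta> x"
  using pos normal_density_pos[of "1 / sqrt \<gamma>" \<mu> \<theta>]
  by (simp add: f_x_given_theta_def f_theta_x_eq f_theta_eq)

lemma f_y_given_theta_eq: "f_y_given_theta \<alpha> \<beta> \<gamma> \<mu> y \<theta> = normal_prec \<alpha> \<theta> y"
proof -
  have "f_theta_y \<alpha> \<beta> \<gamma> \<mu> \<theta> y = normal_prec \<gamma> \<mu> \<theta> * normal_prec \<alpha> \<theta> y"
    using pos by (simp add: f_theta_y_def f_joint_def mult.assoc mult.left_commute[of _ "normal_prec \<alpha> \<theta> y"])
  then show ?thesis
    using pos normal_density_pos[of "1 / sqrt \<gamma>" \<mu> \<theta>] by (simp add: f_y_given_theta_def f_theta_eq)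
qed

lemma f_y_given_theta_x_eq: "f_y_given_theta_x \<alpha> \<beta> \<gamma> \<mu> y \<theta> x = normal_prec \<alpha> \<theta> y"
  using pos normal_density_pos[of "1 / sqrt \<gamma>" \<mu> \<theta>] normal_density_pos[of "1 / sqrt \<beta>" \<theta> x]
  by (simp add: f_y_given_theta_x_def f_joint_def f_theta_x_eq)

abbreviation receiver_density :: "real \<Rightarrow> real \<Rightarrow> real" where
  "receiver_density x \<equiv> normal_prec (\<beta> + \<gamma>) ((\<beta> * x + \<gamma> * \<mu>) / (\<beta> + \<gamma>))"

text \<open>Bayes' rule for the private signal. The factor \<open>C\<close> is the marginal
  \<open>f_x\<close>, since \<open>receiver_density x\<close> integrates to 1.\<close>

lemma f_theta_x_factor:
  obtains C where "C > 0" "\<And>\<theta>. f_theta_x \<alpha> \<beta> \<gamma> \<mu> \<theta> x = C * receiver_density x \<theta>" "f_x \<alpha> \<beta> \<gamma> \<mu> x = C"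
proof -
  obtain C where C: "C > 0" "\<And>\<theta>. normal_prec \<beta> x \<theta> * normal_prec \<gamma> \<mu> \<theta> = C * receiver_density x \<theta>"
    using normal_prec_product[of \<beta> \<gamma>] pos by metis
  have *: "f_theta_x \<alpha> \<beta> \<gamma> \<mu> \<theta> x = C * receiver_density x \<theta>" for \<theta>
    using C(2)[of \<theta>] by (simp add: f_theta_x_eq normal_density_commute[of \<theta>] mult.commute)
  show thesis
    using C(1) pos by (intro that[of C]) (auto simp: * f_x_def)
qed

lemma f_theta_given_x_eq: "f_theta_given_x \<alpha> \<beta> \<gamma> \<mu> \<theta> x = receiver_density x \<theta>"
  by (rule f_theta_x_factor[of x]) (simp add: f_theta_given_x_def)

lemma f_joint_eq: "f_joint \<alpha> \<beta> \<gamma> \<mu> \<theta> x y = f_theta_x \<alpha> \<beta> \<gamma> \<mu> \<theta> x * normal_prec \<alpha> \<theta> y"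
  by (simp add: f_joint_def f_theta_x_eq)

lemma f_y_given_x_eq:
  "f_y_given_x \<alpha> \<beta> \<gamma> \<mu> y x = (LINT \<theta>|lborel. receiver_density x \<theta> * normal_prec \<alpha> \<theta> y)"
  by (rule f_theta_x_factor[of x]) (simp add: f_y_given_x_def f_y_x_def f_joint_eq mult.assoc)

text \<open>A second normal update, by \<open>y\<close>, with \<open>receiver_density x\<close> in
  the role of the prior; the constants of both updates cancel on normalisation.\<close>

lemma f_theta_given_y_x_eq:
  "f_theta_given_y_x \<alpha> \<beta> \<gamma> \<mu> \<theta> y x
    = normal_prec (\<alpha> + \<beta> + \<gamma>) ((\<alpha> * y + \<beta> * x + \<gamma> * \<mu>) / (\<alpha> + \<beta> + \<gamma>)) \<theta>"
proof -
  obtain C where C: "C > 0" "\<And>\<theta>. f_theta_x \<alpha> \<beta> \<gamma> \<mu> \<theta> x = C * receiver_density x \<theta>"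
    using f_theta_x_factor[of x] by metis
  obtain D where D: "D > 0" "\<And>\<theta>. normal_prec \<alpha> y \<theta> * receiver_density x \<theta>
      = D * normal_prec (\<alpha> + (\<beta> + \<gamma>))
          ((\<alpha> * y + (\<beta> + \<gamma>) * ((\<beta> * x + \<gamma> * \<mu>) / (\<beta> + \<gamma>))) / (\<alpha> + (\<beta> + \<gamma>))) \<theta>"
    using normal_prec_product[of \<alpha> "\<beta> + \<gamma>"] pos by (metis add_pos_pos)
  have *: "f_joint \<alpha> \<beta> \<gamma> \<mu> \<theta> x y
      = C * D * normal_prec (\<alpha> + \<beta> + \<gamma>) ((\<alpha> * y + \<beta> * x + \<gamma> * \<mu>) / (\<alpha> + \<beta> + \<gamma>)) \<theta>" for \<theta>
    using D(2)[of \<theta>] C(2)[of \<theta>] pos by (simp add: f_joint_eq normal_density_commute[of \<theta>] add.assoc mult.assoc mult.commute)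
  show ?thesis
    using C(1) D(1) pos by (simp add: f_theta_given_y_x_def f_y_x_def *)
qed

lemma theta_bar_eq: "theta_bar \<alpha> \<beta> \<gamma> \<mu> x = (\<beta> * x + \<gamma> * \<mu>) / (\<beta> + \<gamma>)"
  unfolding theta_bar_def f_theta_given_x_eq using pos by (intro normal_prec_moment) simp

section \<open>The aggregate action and the comparison of payoffs\<close>

text \<open>
  Clamping the index to \<open>[0,1]\<close> extends a profile to a function that is measurable on the whole plane,
  so that the measurability rules for parametric integrals over \<^const>\<open>lborel\<close> apply.
\<close>

lemma aggregate_bounded_measurable:
  assumes s: "s \<in> profiles"
  shows "aggregate \<alpha> \<beta> \<gamma> \<mu> s \<in> borel_measurable borel" "\<bar>aggregate \<alpha> \<beta> \<gamma> \<mu> s \<theta>\<bar> \<le> 1"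
proof -
  define c :: "real \<Rightarrow> real" where "c j = max 0 (min 1 j)" for j
  define u where "u j x = s (c j) x" for j x
  have c01: "c j \<in> {0..1}" for j by (simp add: c_def)
  have u01: "u j x \<in> {0, 1}" for j x
    using s c01[of j] by (fastforce simp: profiles_def u_def)
  have s_meas: "(\<lambda>(j, x). s j x) \<in> borel_measurable (restrict_space borel {0..1} \<Otimes>\<^sub>M borel)"
    using s by (simp add: profiles_def)
  have clamp_meas: "(\<lambda>q. (c (fst q), snd q)) \<in> borel \<Otimes>\<^sub>M borel \<rightarrow>\<^sub>M restrict_space borel {0..1} \<Otimes>\<^sub>M borel"
    using c01 by (intro measurable_Pair measurable_restrict_space2) (auto simp: c_def)
  from measurable_compose[OF clamp_meas s_meas]
  have "(\<lambda>q. u (fst q) (snd q)) \<in> borel_measurable (borel \<Otimes>\<^sub>M borel)"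
    by (simp add: u_def split_beta)
  from measurable_compose[OF measurable_Pair this] have [measurable (raw)]:
    "f \<in> borel_measurable M \<Longrightarrow> g \<in> borel_measurable M \<Longrightarrow> (\<lambda>q. u (f q) (g q)) \<in> borel_measurable M"
    for f g and M :: "'a measure" by simp
  have agg: "aggregate \<alpha> \<beta> \<gamma> \<mu> s
      = (\<lambda>\<theta>. LINT j|lborel. indicator {0..1} j *\<^sub>R (LINT x|lborel. u j x * normal_prec \<beta> \<theta> x))"
    unfolding aggregate_def set_lebesgue_integral_def f_x_given_theta_eq
    by (intro ext Bochner_Integration.integral_cong refl) (auto simp: indicator_def u_def c_def)
  show "aggregate \<alpha> \<beta> \<gamma> \<mu> s \<in> borel_measurable borel" unfolding agg by measurable
  have le: "u j x * normal_prec \<beta> \<theta> x \<le> normal_prec \<beta> \<theta> x" "0 \<le> u j x * normal_prec \<beta> \<theta> x" for j x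
    using u01[of j x] by auto
  have int: "integrable lborel (\<lambda>x. u j x * normal_prec \<beta> \<theta> x)" for j
    by (rule Bochner_Integration.integrable_bound[of _ "normal_prec \<beta> \<theta>"])
      (use le[of j] pos in auto)
  have inner: "0 \<le> (LINT x|lborel. u j x * normal_prec \<beta> \<theta> x)" "(LINT x|lborel. u j x * normal_prec \<beta> \<theta> x) \<le> 1" for j
  proof -
    show "0 \<le> (LINT x|lborel. u j x * normal_prec \<beta> \<theta> x)"
      by (intro Bochner_Integration.integral_nonneg le)
    have "(LINT x|lborel. u j x * normal_prec \<beta> \<theta> x) \<le> (LINT x|lborel. normal_prec \<beta> \<theta> x)"
      using int le pos by (intro integral_mono) auto
    then show "(LINT x|lborel. u j x * normal_prec \<beta> \<theta> x) \<le> 1" using pos by simp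
  qed
  have "\<bar>aggregate \<alpha> \<beta> \<gamma> \<mu> s \<theta>\<bar> \<le> (LINT j|lborel. indicator {0..1::real} j)"
    unfolding agg
  proof (intro order_trans[OF integral_abs_bound] integral_mono')
    show "integrable lborel (indicator {0..1::real} :: real \<Rightarrow> real)"
      by (simp add: integrable_indicator_iff)
  qed (use inner in \<open>auto simp: indicator_def\<close>)
  then show "\<bar>aggregate \<alpha> \<beta> \<gamma> \<mu> s \<theta>\<bar> \<le> 1" by simp
qed

text \<open>The externality contributes the same amount under either action. Boundedness of
  \<open>aggregate\<close> makes that amount a genuine integral, so it can be split off.\<close>

lemma expected_payoff_diff:
  assumes s: "s \<in> profiles"
    and int: "integrable lborel (posterior \<alpha> \<beta> \<gamma> \<mu> p N m x)"
      "integrable lborel (\<lambda>\<theta>. \<theta> * posterior \<alpha> \<beta> \<gamma> \<mu> p N m x \<theta>)"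
  shows "expected_payoff \<alpha> \<beta> \<gamma> \<mu> r p N m s x 1
    = expected_payoff \<alpha> \<beta> \<gamma> \<mu> r p N m s x 0 + (LINT \<theta>|lborel. \<theta> * posterior \<alpha> \<beta> \<gamma> \<mu> p N m x \<theta>)"
proof -
  note [measurable] = aggregate_bounded_measurable(1)[OF s] borel_measurable_integrable[OF int(1)]
  have "integrable lborel (\<lambda>\<theta>. aggregate \<alpha> \<beta> \<gamma> \<mu> s \<theta> * posterior \<alpha> \<beta> \<gamma> \<mu> p N m x \<theta>)"
    by (rule Bochner_Integration.integrable_bound[OF int(1)])
      (use aggregate_bounded_measurable(2)[OF s] in \<open>auto simp: abs_mult intro!: mult_left_le_one_le\<close>)
  then have "integrable lborel (\<lambda>\<theta>. r * (aggregate \<alpha> \<beta> \<gamma> \<mu> s \<theta> * posterior \<alpha> \<beta> \<gamma> \<mu> p N m x \<theta>))"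
    by simp
  from Bochner_Integration.integral_add[OF this int(2)] show ?thesis
    by (simp add: expected_payoff_def distrib_right mult.assoc del: integral_mult_right_zero)
qed

text \<open>The payoff comparison is the same against every profile, so the optimal action is
  dominant and the equilibrium unique. The sign condition is weak because an indifferent receiver
  takes action 1.\<close>

lemma equilibrium_iff_threshold:
  assumes int: "\<And>x. integrable lborel (posterior \<alpha> \<beta> \<gamma> \<mu> p N m x)"
      "\<And>x. integrable lborel (\<lambda>\<theta>. \<theta> * posterior \<alpha> \<beta> \<gamma> \<mu> p N m x \<theta>)"
    and sign: "\<And>x. 0 \<le> (LINT \<theta>|lborel. \<theta> * posterior \<alpha> \<beta> \<gamma> \<mu> p N m x \<theta>) \<longleftrightarrow> z \<le> x"
  shows "equilibrium \<alpha> \<beta> \<gamma> \<mu> r p N m s \<longleftrightarrow> s = threshold_profile z"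
proof
  let ?U = "expected_payoff \<alpha> \<beta> \<gamma> \<mu> r p N m"
  have *: "?U t x 0 \<le> ?U t x 1 \<longleftrightarrow> z \<le> x" if "t \<in> profiles" for t x
    using expected_payoff_diff[OF that int] sign[of x] by simp
  show "equilibrium \<alpha> \<beta> \<gamma> \<mu> r p N m s" if "s = threshold_profile z"
  proof -
    have s: "s \<in> profiles" using that threshold_profile_in_profiles by simp
    have "(\<forall>a\<in>{0, 1}. ?U s x a \<le> ?U s x (s i x)) \<and> (?U s x 0 = ?U s x 1 \<longrightarrow> s i x = 1)"
      if "i \<in> {0..1}" for i x
    proof -
      have "s i x = (if x \<ge> z then 1 else 0)"
        using that \<open>s = threshold_profile z\<close> by (simp add: threshold_profile_def)
      then show ?thesis using *[OF s, of x] by (cases "z \<le> x") auto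
    qed
    with s show ?thesis by (simp add: equilibrium_def)
  qed
  assume eq: "equilibrium \<alpha> \<beta> \<gamma> \<mu> r p N m s"
  then have s: "s \<in> profiles" by (simp add: equilibrium_def)
  then have s_PiE: "s \<in> {0..1} \<rightarrow>\<^sub>E (UNIV \<rightarrow> {0, 1})" by (simp add: profiles_def)
  show "s = threshold_profile z"
  proof (rule ext)
    fix i
    show "s i = threshold_profile z i"
    proof (cases "i \<in> {0..1}")
      case True
      have s_eq: "s i x = (if x \<ge> z then 1 else 0)" for x
      proof -
        have "s i x \<in> {0, 1}" using s_PiE True by (fastforce simp: PiE_def)
        moreover have "?U s x 0 \<le> ?U s x (s i x)" "?U s x 1 \<le> ?U s x (s i x)"
            "?U s x 0 = ?U s x 1 \<Longrightarrow> s i x = 1"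
          using eq True by (auto simp: equilibrium_def)
        ultimately show ?thesis using *[OF s, of x] by auto
      qed
      show ?thesis using True by (simp add: threshold_profile_def fun_eq_iff s_eq)
    next
      case False
      \<comment> \<open>Outside \<open>[0,1]\<close> both profiles take the default value
        \<open>undefined\<close>.\<close>
      then show ?thesis using PiE_arb[OF s_PiE False] by (auto simp: threshold_profile_def)
    qed
  qed
qed

section \<open>Equilibrium after a disclosed signal\<close>

text \<open>The posterior mean has the sign of
  \<open>\<alpha> * y + \<beta> * x + \<gamma> * \<mu>\<close>, which is increasing in
  \<open>x\<close> and vanishes at the threshold.\<close>

lemma equilibrium_Some:
  "equilibrium \<alpha> \<beta> \<gamma> \<mu> r p N (Some y) s \<longleftrightarrow> s = threshold_profile (- (1 / \<beta>) * (\<alpha> * y + \<gamma> * \<mu>))"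
proof (rule equilibrium_iff_threshold)
  fix x
  have post: "posterior \<alpha> \<beta> \<gamma> \<mu> p N (Some y) x
      = normal_prec (\<alpha> + \<beta> + \<gamma>) ((\<alpha> * y + \<beta> * x + \<gamma> * \<mu>) / (\<alpha> + \<beta> + \<gamma>))"
    by (simp add: fun_eq_iff posterior_def f_theta_given_y_x_eq)
  have abc: "0 < \<alpha> + \<beta> + \<gamma>" using pos by simp
  show "integrable lborel (posterior \<alpha> \<beta> \<gamma> \<mu> p N (Some y) x)"
    using abc by (simp add: post)
  show "integrable lborel (\<lambda>\<theta>. \<theta> * posterior \<alpha> \<beta> \<gamma> \<mu> p N (Some y) x \<theta>)"
    using normal_prec_moment(1)[OF abc] by (simp add: post)
  show "0 \<le> (LINT \<theta>|lborel. \<theta> * posterior \<alpha> \<beta> \<gamma> \<mu> p N (Some y) x \<theta>) \<longleftrightarrow> - (1 / \<beta>) * (\<alpha> * y + \<gamma> * \<mu>) \<le> x"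
    using abc pos by (simp only: post normal_prec_moment(2)[OF abc]) (simp add: zero_le_divide_iff field_simps, linarith)
qed

section \<open>Equilibrium after silence\<close>

text \<open>
  \<open>E[\<theta>|x, y \<in> S]\<close>. If \<open>S\<close> is a null set, this is \<open>0 / 0 = 0\<close>, the value that the definition of the
  posterior gives to the corresponding term.
\<close>

definition silent_mean :: "real set \<Rightarrow> real \<Rightarrow> real" where
  "silent_mean S x = (LINT \<theta>|lborel. \<theta> * receiver_density x \<theta> * normal_set S \<alpha> \<theta>)
    / (LINT \<theta>|lborel. receiver_density x \<theta> * normal_set S \<alpha> \<theta>)"

lemma receiver_density_integrable:
  "integrable lborel (receiver_density x)" "integrable lborel (\<lambda>\<theta>. \<theta> * receiver_density x \<theta>)"
  using pos normal_prec_moment(1)[of "\<beta> + \<gamma>"] by (simp_all add: add_pos_pos)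

text \<open>Tilting the law at signal 0 by \<open>exp (\<beta> * x * \<theta>)\<close> yields the
  law at signal \<open>x\<close> up to a constant that cancels in the quotient. Hence
  \<open>silent_mean S x\<close> is the tilted mean at \<open>\<beta> * x\<close>; for a null set it
  is constantly 0.\<close>

lemma silent_mean_mono_continuous:
  assumes S: "S \<in> sets borel"
  shows "mono (silent_mean S) \<and> continuous_on UNIV (silent_mean S)"
proof (cases "\<forall>t. normal_set S \<alpha> t = 0")
  case True
  then have "silent_mean S = (\<lambda>x. 0)" by (simp add: silent_mean_def fun_eq_iff)
  then show ?thesis by (simp add: mono_def)
next
  case False
  then have P_pos: "0 < normal_set S \<alpha> t" for t
    using normal_set_zero_or_pos[OF S pos(1)] by blast
  define w where "w \<theta> = receiver_density 0 \<theta> * normal_set S \<alpha> \<theta>" for \<theta>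
  have w_pos: "0 < w \<theta>" for \<theta>
    using P_pos pos by (simp add: w_def normal_density_pos)
  have tilt: "\<exists>C>0. \<forall>\<theta>. exp (s * \<theta>) * w \<theta> = C * (receiver_density (s / \<beta>) \<theta> * normal_set S \<alpha> \<theta>)" for s
  proof -
    obtain C where "C > 0" "\<And>\<theta>. exp (s * \<theta>) * receiver_density 0 \<theta>
        = C * normal_prec (\<beta> + \<gamma>) ((\<beta> * 0 + \<gamma> * \<mu>) / (\<beta> + \<gamma>) + s / (\<beta> + \<gamma>)) \<theta>"
      using normal_prec_tilt[of "\<beta> + \<gamma>"] pos by (metis add_pos_pos)
    then show ?thesis using pos
      by (intro exI[of _ C]) (simp add: w_def mult.assoc[symmetric] add_divide_distrib add.commute)
  qed
  have int0: "integrable lborel (\<lambda>\<theta>. exp (s * \<theta>) * w \<theta>)" for s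
  proof -
    obtain C where "\<forall>\<theta>. exp (s * \<theta>) * w \<theta> = C * (receiver_density (s / \<beta>) \<theta> * normal_set S \<alpha> \<theta>)"
      using tilt by blast
    then show ?thesis
      by (simp only:) (intro integrable_mult_right integrable_mult_normal_set S pos receiver_density_integrable)
  qed
  have int1: "integrable lborel (\<lambda>\<theta>. exp (s * \<theta>) * (\<theta> * w \<theta>))" for s
  proof -
    obtain C where "\<forall>\<theta>. exp (s * \<theta>) * w \<theta> = C * (receiver_density (s / \<beta>) \<theta> * normal_set S \<alpha> \<theta>)"
      using tilt by blast
    then have "(\<lambda>\<theta>. exp (s * \<theta>) * (\<theta> * w \<theta>))
        = (\<lambda>\<theta>. C * (\<theta> * receiver_density (s / \<beta>) \<theta> * normal_set S \<alpha> \<theta>))"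
      by (simp add: fun_eq_iff mult_ac)
    then show ?thesis
      by (simp only:) (intro integrable_mult_right integrable_mult_normal_set S pos receiver_density_integrable)
  qed
  \<comment> \<open>An everywhere positive integrand cannot vanish almost everywhere, as
    \<open>lborel\<close> is not the zero measure.\<close>
  have Z_pos: "0 < (LINT \<theta>|lborel. exp (s * \<theta>) * w \<theta>)" for s
  proof -
    have "(LINT \<theta>|lborel. exp (s * \<theta>) * w \<theta>) \<noteq> 0"
      using int0[of s] w_pos by (subst integral_nonneg_eq_0_iff_AE) (simp_all add: less_imp_le less_imp_neq[symmetric] ae_filter_eq_bot_iff)
    moreover have "0 \<le> (LINT \<theta>|lborel. exp (s * \<theta>) * w \<theta>)"
      using w_pos by (intro Bochner_Integration.integral_nonneg) (simp add: less_imp_le)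
    ultimately show ?thesis by simp
  qed
  define M where "M s = (LINT \<theta>|lborel. exp (s * \<theta>) * (\<theta> * w \<theta>)) / (LINT \<theta>|lborel. exp (s * \<theta>) * w \<theta>)" for s
  have "mono M"
    unfolding M_def[abs_def] using w_pos int0 int1 Z_pos by (intro tilted_mean_mono) (auto simp: less_imp_le)
  moreover have "continuous_on UNIV M"
    unfolding M_def[abs_def] using int0 int1 Z_pos
    by (intro continuous_on_divide integral_exp_tilt_continuous) (auto simp: less_imp_neq[symmetric])
  moreover have "silent_mean S = (\<lambda>x. M (\<beta> * x))"
  proof
    fix x
    obtain C where C: "C > 0"
      "\<And>\<theta>. exp (\<beta> * x * \<theta>) * w \<theta> = C * (receiver_density x \<theta> * normal_set S \<alpha> \<theta>)"
      using tilt[of "\<beta> * x"] pos by auto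
    have *: "exp (\<beta> * x * \<theta>) * (\<theta> * w \<theta>) = C * (\<theta> * receiver_density x \<theta> * normal_set S \<alpha> \<theta>)" for \<theta>
      using C(2)[of \<theta>] by (simp add: mult_ac)
    show "silent_mean S x = M (\<beta> * x)"
      unfolding M_def silent_mean_def * C(2) using C(1) by simp
  qed
  ultimately show ?thesis
    using pos by (auto simp: mono_def intro!: continuous_on_compose2[of UNIV M] continuous_intros)
qed

text \<open>The posterior mean after silence and the left side of the threshold equation are the
  same function of the signal, so one root governs both.\<close>

lemma equilibrium_None:
  assumes p: "0 < p" "p < 1" and N: "N \<in> sets lebesgue"
  obtains z where
    "\<And>s. equilibrium \<alpha> \<beta> \<gamma> \<mu> r p N None s \<longleftrightarrow> s = threshold_profile z"
    "\<And>t. (1 - p) * theta_bar \<alpha> \<beta> \<gamma> \<mu> t +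
           p * (LINT y:N|lebesgue.
             (LINT \<theta>|lborel. \<theta> * f_y_given_theta \<alpha> \<beta> \<gamma> \<mu> y \<theta> * f_theta_given_x \<alpha> \<beta> \<gamma> \<mu> \<theta> t) /
             (LINT y':N|lebesgue. f_y_given_x \<alpha> \<beta> \<gamma> \<mu> y' t)) = 0 \<longleftrightarrow> t = z"
proof -
  obtain S where S[measurable]: "S \<in> sets borel" and NS:
    "\<And>f :: real \<Rightarrow> real. f \<in> borel_measurable borel \<Longrightarrow> (LINT y:N|lebesgue. f y) = (LINT y:S|lborel. f y)"
    using lebesgue_set_borel_representative[OF N] by blast
  \<comment> \<open>The probability of \<open>y\<close> lying in \<open>N\<close> given
    \<open>x\<close>, written as an average over \<theta>.\<close>
  define D where "D x = (LINT \<theta>|lborel. receiver_density x \<theta> * normal_set S \<alpha> \<theta>)" for x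
  have D_eq: "(LINT y:N|lebesgue. f_y_given_x \<alpha> \<beta> \<gamma> \<mu> y x) = D x" for x
    unfolding f_y_given_x_eq D_def
    by (subst NS, measurable) (rule set_integral_normal_mixture[OF S pos(1) receiver_density_integrable(1)])
  have num_eq: "(LINT y:N|lebesgue. LINT \<theta>|lborel. \<theta> * normal_prec \<alpha> \<theta> y * receiver_density x \<theta>)
      = (LINT \<theta>|lborel. \<theta> * receiver_density x \<theta> * normal_set S \<alpha> \<theta>)" for x
    using set_integral_normal_mixture[OF S pos(1) receiver_density_integrable(2)[of x]]
    by (subst NS, measurable) (simp add: mult_ac)
  \<comment> \<open>Given \<theta>, the law of \<open>y\<close> is free of \<open>x\<close>;
    integrating it over \<open>N\<close> therefore gives a weight in \<theta> alone.\<close>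
  have post: "posterior \<alpha> \<beta> \<gamma> \<mu> p N None x \<theta>
      = (1 - p) * receiver_density x \<theta> + p / D x * (receiver_density x \<theta> * normal_set S \<alpha> \<theta>)" for x \<theta>
    by (simp add: posterior_def f_y_given_theta_x_eq f_theta_given_x_eq D_eq NS normal_set_def[OF S pos(1)]
        algebra_simps)
  \<comment> \<open>The common function: posterior mean and left side of the equation. If
    \<open>S\<close> is null, every quotient by \<open>D x\<close> is 0 and the identities
    persist.\<close>
  define G where "G x = (1 - p) * ((\<beta> * x + \<gamma> * \<mu>) / (\<beta> + \<gamma>)) + p * silent_mean S x" for x
  have int: "integrable lborel (\<lambda>\<theta>. \<theta> * receiver_density x \<theta> * normal_set S \<alpha> \<theta>)" 
      "integrable lborel (\<lambda>\<theta>. receiver_density x \<theta> * normal_set S \<alpha> \<theta>)" for x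
    using integrable_mult_normal_set[OF S pos(1)] receiver_density_integrable by auto
  have post_mean: "(\<lambda>\<theta>. \<theta> * posterior \<alpha> \<beta> \<gamma> \<mu> p N None x \<theta>)
      = (\<lambda>\<theta>. (1 - p) * (\<theta> * receiver_density x \<theta>) + p / D x * (\<theta> * receiver_density x \<theta> * normal_set S \<alpha> \<theta>))" for x
    by (simp add: fun_eq_iff post algebra_simps)
  have G_eq: "(LINT \<theta>|lborel. \<theta> * posterior \<alpha> \<beta> \<gamma> \<mu> p N None x \<theta>) = G x" for x
    unfolding post_mean using int[of x] receiver_density_integrable(2)[of x] normal_prec_moment(2)[of "\<beta> + \<gamma>"] pos
    by (simp add: G_def silent_mean_def D_def add_pos_pos)
  \<comment> \<open>The intercept of the affine mean joins the monotone part; the remaining slope is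
    positive because \<open>p < 1\<close>.\<close>
  have mono: "mono (\<lambda>x. (1 - p) * \<gamma> * \<mu> / (\<beta> + \<gamma>) + p * silent_mean S x)"
    and cont: "continuous_on UNIV (\<lambda>x. (1 - p) * \<gamma> * \<mu> / (\<beta> + \<gamma>) + p * silent_mean S x)"
    using silent_mean_mono_continuous[OF S] p by (auto simp: mono_def intro!: continuous_intros)
  have slope: "0 < (1 - p) * \<beta> / (\<beta> + \<gamma>)" using pos p by simp
  obtain z where z:
    "\<And>x. 0 \<le> (1 - p) * \<beta> / (\<beta> + \<gamma>) * x + ((1 - p) * \<gamma> * \<mu> / (\<beta> + \<gamma>) + p * silent_mean S x) \<longleftrightarrow> z \<le> x"
    "\<And>x. (1 - p) * \<beta> / (\<beta> + \<gamma>) * x + ((1 - p) * \<gamma> * \<mu> / (\<beta> + \<gamma>) + p * silent_mean S x) = 0 \<longleftrightarrow> x = z"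
    using linear_plus_mono_root[OF slope mono cont] by blast
  have G_linear: "(1 - p) * \<beta> / (\<beta> + \<gamma>) * x + ((1 - p) * \<gamma> * \<mu> / (\<beta> + \<gamma>) + p * silent_mean S x) = G x" for x
    by (simp add: G_def add_divide_distrib algebra_simps)
  show thesis
  proof
    show "equilibrium \<alpha> \<beta> \<gamma> \<mu> r p N None s \<longleftrightarrow> s = threshold_profile z" for s
    proof (rule equilibrium_iff_threshold)
      show "integrable lborel (posterior \<alpha> \<beta> \<gamma> \<mu> p N None x)" for x
        unfolding post[abs_def] using int receiver_density_integrable by simp
      show "integrable lborel (\<lambda>\<theta>. \<theta> * posterior \<alpha> \<beta> \<gamma> \<mu> p N None x \<theta>)" for x
        unfolding post_mean using int receiver_density_integrable by simp
    qed (use z(1) in \<open>simp only: G_eq G_linear\<close>)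
    show "(1 - p) * theta_bar \<alpha> \<beta> \<gamma> \<mu> t +
           p * (LINT y:N|lebesgue.
             (LINT \<theta>|lborel. \<theta> * f_y_given_theta \<alpha> \<beta> \<gamma> \<mu> y \<theta> * f_theta_given_x \<alpha> \<beta> \<gamma> \<mu> \<theta> t) /
             (LINT y':N|lebesgue. f_y_given_x \<alpha> \<beta> \<gamma> \<mu> y' t)) = 0 \<longleftrightarrow> t = z" for t
      using z(2)[of t] unfolding G_linear
      by (simp only: D_eq f_y_given_theta_eq f_theta_given_x_eq num_eq theta_bar_eq G_def silent_mean_def
          set_integral_divide_zero D_def)
  qed
qed

end

theorem proposition3p1:
  fixes \<alpha> \<beta> \<gamma> \<mu> r p :: real and N :: "real set"
  assumes "\<alpha> > 0" and "\<beta> > 0" and "\<gamma> > 0"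
    and "0 < p" and "p < 1"
    and "N \<in> sets lebesgue"
  shows "\<exists>xhat :: real option \<Rightarrow> real.
    (\<forall>m\<in>messages N.
       (\<exists>!s. equilibrium \<alpha> \<beta> \<gamma> \<mu> r p N m s) \<and>
       (\<forall>s. equilibrium \<alpha> \<beta> \<gamma> \<mu> r p N m s \<longrightarrow>
          (\<forall>i\<in>{0..1}. \<forall>x. s i x = (if x \<ge> xhat m then 1 else 0)))) \<and>
    (\<forall>y\<in>- N. xhat (Some y) = - (1 / \<beta>) * (\<alpha> * y + \<gamma> * \<mu>)) \<and>
    (\<forall>y\<in>- N. \<forall>y'\<in>- N. y < y' \<longrightarrow> xhat (Some y') < xhat (Some y)) \<and>
    (\<forall>t. (1 - p) * theta_bar \<alpha> \<beta> \<gamma> \<mu> t +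
           p * (LINT y:N|lebesgue.
             (LINT \<theta>|lborel. \<theta> * f_y_given_theta \<alpha> \<beta> \<gamma> \<mu> y \<theta> * f_theta_given_x \<alpha> \<beta> \<gamma> \<mu> \<theta> t) /
             (LINT y':N|lebesgue. f_y_given_x \<alpha> \<beta> \<gamma> \<mu> y' t)) = 0
         \<longleftrightarrow> t = xhat None)"
proof -
  obtain z where z:
    "\<And>s. equilibrium \<alpha> \<beta> \<gamma> \<mu> r p N None s \<longleftrightarrow> s = threshold_profile z"
    "\<And>t. (1 - p) * theta_bar \<alpha> \<beta> \<gamma> \<mu> t +
           p * (LINT y:N|lebesgue.
             (LINT \<theta>|lborel. \<theta> * f_y_given_theta \<alpha> \<beta> \<gamma> \<mu> y \<theta> * f_theta_given_x \<alpha> \<beta> \<gamma> \<mu> \<theta> t) /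
             (LINT y':N|lebesgue. f_y_given_x \<alpha> \<beta> \<gamma> \<mu> y' t)) = 0 \<longleftrightarrow> t = z"
    using equilibrium_None[OF assms(1-6), of \<mu> r] by blast
  define xhat where "xhat m = (case m of None \<Rightarrow> z | Some y \<Rightarrow> - (1 / \<beta>) * (\<alpha> * y + \<gamma> * \<mu>))" for m
  \<comment> \<open>This equivalence carries existence, uniqueness and the threshold form at
    once.\<close>
  have eq: "equilibrium \<alpha> \<beta> \<gamma> \<mu> r p N m s \<longleftrightarrow> s = threshold_profile (xhat m)" for m s
    by (cases m) (simp_all add: xhat_def z(1) equilibrium_Some[OF assms(1-3)])
  have "xhat (Some y') < xhat (Some y)" if "y < y'" for y y'
    using that assms(1,2) by (simp add: xhat_def divide_strict_right_mono)
  moreover have "xhat (Some y) = - (1 / \<beta>) * (\<alpha> * y + \<gamma> * \<mu>)" "xhat None = z" for y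
    by (simp_all add: xhat_def)
  ultimately show ?thesis
    using z(2) by (intro exI[of _ xhat]) (simp add: eq threshold_profile_def)
qed

end
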